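(* Let $V$ be a finite-dimensional real vector space with inner product $(\cdot,\cdot)$, let $\Phi\subset V$ be an irreducible (not necessarily reduced) root system with an ordering, with simple roots $\Pi=\{\alpha_1,\dots,\alpha_l\}$ and highest root $\psi$. Put $\triangle'=\{x\in V:(x,\alpha_i)\ge0\ (1\le i\le l),\ (x,\psi)=1\}$ and $i(\Phi)=\min_{x\in\triangle'}(x,x)^{1/2}$. Then $$i(\Phi)=(\psi,\psi)^{-1/2}.$$
   Context: A root system $\Phi\subset V$ is understood to be crystallographic, to span $V$ ($\dim V=l$), and to be taken with respect to the inner product $(\cdot,\cdot)$, which is invariant under its Weyl group. *)

theory Defs
  imports "HOL-Analysis.Analysis"
begin

text \<open>Reflections are taken with respect to the inner product of the ambient
  Euclidean space, so this inner product is automatically invariant under the Weyl group.\<close>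

definition root_reflection :: "'a::euclidean_space \<Rightarrow> 'a \<Rightarrow> 'a" where
  "root_reflection \<alpha> x = x - (2 * (x \<bullet> \<alpha>) / (\<alpha> \<bullet> \<alpha>)) *\<^sub>R \<alpha>"

text \<open>Multiples of a root other than its negative are allowed, so a root system need not
  be reduced.\<close>

definition root_system :: "'a::euclidean_space set \<Rightarrow> bool" where
  "root_system \<Phi> \<longleftrightarrow>
     finite \<Phi> \<and> 0 \<notin> \<Phi> \<and> span \<Phi> = UNIV \<and>
     (\<forall>\<alpha>\<in>\<Phi>. \<forall>\<beta>\<in>\<Phi>. root_reflection \<alpha> \<beta> \<in> \<Phi>) \<and>
     (\<forall>\<alpha>\<in>\<Phi>. \<forall>\<beta>\<in>\<Phi>. 2 * (\<beta> \<bullet> \<alpha>) / (\<alpha> \<bullet> \<alpha>) \<in> \<int>)"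

definition irreducible_root_system :: "'a::euclidean_space set \<Rightarrow> bool" where
  "irreducible_root_system \<Phi> \<longleftrightarrow>
     root_system \<Phi> \<and> \<Phi> \<noteq> {} \<and>
     \<not> (\<exists>A B. A \<noteq> {} \<and> B \<noteq> {} \<and> A \<inter> B = {} \<and> A \<union> B = \<Phi> \<and>
            (\<forall>\<alpha>\<in>A. \<forall>\<beta>\<in>B. \<alpha> \<bullet> \<beta> = 0))"

text \<open>An ordering of a root system is induced by a total order on the ambient space that is
  compatible with the vector space structure; \<open>(x, y) \<in> r\<close> means that \<open>x\<close> is at most \<open>y\<close>.\<close>

definition vector_ordering :: "'a::real_vector rel \<Rightarrow> bool" where
  "vector_ordering r \<longleftrightarrow>
     linear_order r \<and>
     (\<forall>x y z. (x, y) \<in> r \<longrightarrow> (x + z, y + z) \<in> r) \<and>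
     (\<forall>x y c. (x, y) \<in> r \<longrightarrow> 0 \<le> c \<longrightarrow> (c *\<^sub>R x, c *\<^sub>R y) \<in> r)"

definition positive_roots :: "'a::real_vector set \<Rightarrow> 'a rel \<Rightarrow> 'a set" where
  "positive_roots \<Phi> r = {\<alpha>\<in>\<Phi>. (0, \<alpha>) \<in> r \<and> \<alpha> \<noteq> 0}"

definition simple_roots :: "'a::real_vector set \<Rightarrow> 'a rel \<Rightarrow> 'a set" where
  "simple_roots \<Phi> r =
     {\<alpha>\<in>positive_roots \<Phi> r.
        \<not> (\<exists>\<beta>\<in>positive_roots \<Phi> r. \<exists>\<gamma>\<in>positive_roots \<Phi> r. \<alpha> = \<beta> + \<gamma>)}"

definition highest_root :: "'a::real_vector set \<Rightarrow> 'a rel \<Rightarrow> 'a \<Rightarrow> bool" where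
  "highest_root \<Phi> r \<psi> \<longleftrightarrow> \<psi> \<in> \<Phi> \<and> (\<forall>\<alpha>\<in>\<Phi>. (\<alpha>, \<psi>) \<in> r)"

definition triangle' :: "'a::euclidean_space set \<Rightarrow> 'a rel \<Rightarrow> 'a \<Rightarrow> 'a set" where
  "triangle' \<Phi> r \<psi> = {x. (\<forall>\<alpha>\<in>simple_roots \<Phi> r. x \<bullet> \<alpha> \<ge> 0) \<and> x \<bullet> \<psi> = 1}"

text \<open>\<open>Least\<close> is meaningful only if the minimum is attained; \<open>is_minimum\<close> says that it is.\<close>

definition is_minimum :: "real set \<Rightarrow> real \<Rightarrow> bool" where
  "is_minimum S m \<longleftrightarrow> m \<in> S \<and> (\<forall>s\<in>S. m \<le> s)"

definition i_root_system :: "'a::euclidean_space set \<Rightarrow> 'a rel \<Rightarrow> 'a \<Rightarrow> real" where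
  "i_root_system \<Phi> r \<psi> = (LEAST s. s \<in> (\<lambda>x. sqrt (x \<bullet> x)) ` triangle' \<Phi> r \<psi>)"

end

(* The point \<psi>/(\<psi>,\<psi>) lies in triangle': if (\<psi>,\<alpha>) < 0 for a positive root \<alpha>, the reflection
   of \<psi> in \<alpha> would be a root higher than \<psi>. By the Cauchy-Schwarz inequality no point
   of the hyperplane (x,\<psi>) = 1 has a smaller norm. *)

theory Submission imports Defs
begin

lemma highest_root_inner_nonneg:
  fixes \<Phi> :: "'a::euclidean_space set"
  assumes \<Phi>: "root_system \<Phi>" and r: "vector_ordering r" and \<psi>: "highest_root \<Phi> r \<psi>"
    and \<alpha>: "\<alpha> \<in> positive_roots \<Phi> r"
  shows "0 \<le> \<psi> \<bullet> \<alpha>"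
proof (rule ccontr)
  assume neg: "\<not> 0 \<le> \<psi> \<bullet> \<alpha>"
  have \<alpha>': "\<alpha> \<in> \<Phi>" "(0, \<alpha>) \<in> r" "\<alpha> \<noteq> 0"
    using \<alpha> by (auto simp: positive_roots_def)
  \<comment> \<open>Negated, the Cartan number of \<open>\<psi>\<close> along
    \<open>\<alpha>\<close> is the positive amount of \<open>\<alpha>\<close> that the reflection
    adds to \<open>\<psi>\<close>.\<close>
  define c where "c = - (2 * (\<psi> \<bullet> \<alpha>) / (\<alpha> \<bullet> \<alpha>))"
  have c: "c > 0"
    using neg \<alpha>' by (simp add: c_def divide_neg_pos)
  have refl: "root_reflection \<alpha> \<psi> = c *\<^sub>R \<alpha> + \<psi>"
    by (simp add: root_reflection_def c_def)
  have "root_reflection \<alpha> \<psi> \<in> \<Phi>"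
    using \<Phi> \<psi> \<alpha>' by (auto simp: root_system_def highest_root_def)
  then have upper: "(c *\<^sub>R \<alpha> + \<psi>, \<psi>) \<in> r"
    using \<psi> refl by (auto simp: highest_root_def)
  \<comment> \<open>Scaling \<open>0 \<le> \<alpha>\<close> by \<open>c\<close>, then translating by
    \<open>\<psi>\<close>, puts \<open>\<psi>\<close> below its reflection; with
    \<open>upper\<close>, antisymmetry makes the two equal.\<close>
  have "(c *\<^sub>R 0, c *\<^sub>R \<alpha>) \<in> r"
    using r \<alpha>' c unfolding vector_ordering_def by (meson less_imp_le)
  then have "(c *\<^sub>R 0 + \<psi>, c *\<^sub>R \<alpha> + \<psi>) \<in> r"
    using r unfolding vector_ordering_def by blast
  moreover have "antisym r"
    using r by (simp add: vector_ordering_def order_on_defs)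
  ultimately have "c *\<^sub>R \<alpha> + \<psi> = \<psi>"
    using upper by (auto dest: antisymD)
  then show False
    using c \<alpha>' by simp
qed

lemma is_minimum_triangle'_norm:
  fixes \<Phi> :: "'a::euclidean_space set"
  assumes "root_system \<Phi>" "vector_ordering r" "highest_root \<Phi> r \<psi>"
  shows "is_minimum ((\<lambda>x. sqrt (x \<bullet> x)) ` triangle' \<Phi> r \<psi>) (1 / norm \<psi>)"
proof -
  have \<psi>: "\<psi> \<noteq> 0"
    using assms by (auto simp: root_system_def highest_root_def)
  \<comment> \<open>The foot of the perpendicular from the origin to the hyperplane
    \<open>x \<bullet> \<psi> = 1\<close>. It satisfies the remaining inequalities because simple
    roots are positive.\<close>
  define p where "p = (1 / (\<psi> \<bullet> \<psi>)) *\<^sub>R \<psi>"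
  have "p \<in> triangle' \<Phi> r \<psi>"
    using highest_root_inner_nonneg[OF assms] \<psi>
    by (auto simp: triangle'_def simple_roots_def p_def)
  moreover have "norm p = 1 / norm \<psi>"
    using \<psi> by (simp add: p_def power2_norm_eq_inner[symmetric] power2_eq_square)
  moreover have "1 / norm \<psi> \<le> norm x" if "x \<in> triangle' \<Phi> r \<psi>" for x
    using that norm_cauchy_schwarz[of x \<psi>] \<psi> by (simp add: triangle'_def divide_simps)
  ultimately show ?thesis
    by (force simp: is_minimum_def norm_eq_sqrt_inner[symmetric])
qed

theorem mainTheorem6:
  fixes \<Phi> :: "'a::euclidean_space set" and r :: "'a rel" and \<psi> :: 'a
  assumes "irreducible_root_system \<Phi>"
    and "vector_ordering r"
    and "highest_root \<Phi> r \<psi>"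
  shows "is_minimum ((\<lambda>x. sqrt (x \<bullet> x)) ` triangle' \<Phi> r \<psi>) (i_root_system \<Phi> r \<psi>) \<and>
         i_root_system \<Phi> r \<psi> = (\<psi> \<bullet> \<psi>) powr (- 1 / 2)"
proof -
  have min: "is_minimum ((\<lambda>x. sqrt (x \<bullet> x)) ` triangle' \<Phi> r \<psi>) (1 / norm \<psi>)"
    using assms by (intro is_minimum_triangle'_norm) (auto simp: irreducible_root_system_def)
  then have "i_root_system \<Phi> r \<psi> = 1 / norm \<psi>"
    \<comment> \<open>\<open>LEAST\<close> over the reals is pinned down only by an attained
      minimum, which \<open>min\<close> supplies.\<close>
    unfolding i_root_system_def is_minimum_def by (intro Least_equality) auto
  \<comment> \<open>No case split on \<open>\<psi>\<close>: at 0 both sides are 0 by the conventions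
    for \<open>powr\<close> and division.\<close>
  moreover have "(\<psi> \<bullet> \<psi>) powr (- 1 / 2) = 1 / norm \<psi>"
    by (simp add: powr_minus_divide powr_half_sqrt norm_eq_sqrt_inner)
  ultimately show ?thesis
    using min by simp
qed

end
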